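(* Let $n$ be a positive integer, let $k\in\{1,\ldots,n\}$, and let $A$ be an $n\times n$ complex matrix. If $A$ is $k$-spectrally monomorphic, then $A$ is $l$-spectrally monomorphic for each $l\in\{1,\ldots,\min(k,n-k)\}$.
   Context: For an $n\times n$ complex matrix $A$ and $\alpha\subseteq\{1,\ldots,n\}$, $A[\alpha]$ denotes the principal submatrix of $A$ with rows and columns indexed by $\alpha$. The matrix $A$ is $k$-spectrally monomorphic if all its $k\times k$ principal submatrices $A[\alpha]$, $|\alpha|=k$, have the same characteristic polynomial. *)

theory Defs
  imports
    "Jordan_Normal_Form.Char_Poly"
    "Jordan_Normal_Form.DL_Submatrix"
begin

text \<open>Rows and columns of an \<open>n \<times> n\<close> matrix are indexed by \<open>0, \<dots>, n - 1\<close>, and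
  \<^const>\<open>submatrix\<close> lists the selected rows and columns in increasing order.\<close>

definition principal_submatrix :: "'a mat \<Rightarrow> nat set \<Rightarrow> 'a mat" where
  "principal_submatrix A \<alpha> = submatrix A \<alpha> \<alpha>"

definition spectrally_monomorphic :: "nat \<Rightarrow> complex mat \<Rightarrow> bool" where
  "spectrally_monomorphic k A \<longleftrightarrow>
     (\<forall>\<alpha> \<beta>. \<alpha> \<subseteq> {..<dim_row A} \<and> card \<alpha> = k \<and> \<beta> \<subseteq> {..<dim_row A} \<and> card \<beta> = k \<longrightarrow>
        char_poly (principal_submatrix A \<alpha>) = char_poly (principal_submatrix A \<beta>))"

end

theory Submission
  imports Defs
begin

text \<open>
  Write \<open>p \<gamma>\<close> for the characteristic polynomial of \<open>A[\<gamma>]\<close>. Differentiating \<open>det (x I - A[\<alpha>])\<close>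
  row by row gives \<open>(p \<alpha>)' = \<Sum>i\<in>\<alpha>. p (\<alpha> - {i})\<close>, so the \<open>(k - l)\<close>-th derivative of \<open>p \<alpha>\<close>
  is \<open>(k - l)!\<close> times the sum of \<open>p \<gamma>\<close> over the \<open>l\<close>-subsets \<open>\<gamma>\<close> of the \<open>k\<close>-set \<open>\<alpha>\<close>. If \<open>p\<close> takes the
  same value on all \<open>k\<close>-sets, then so do these sums (\<open>char_poly_subset_sums_eq\<close>).

  It remains to recover \<open>p\<close> on \<open>l\<close>-sets from its sums over the \<open>l\<close>-subsets of \<open>k\<close>-sets. This is a
  purely combinatorial matter, and it is where \<open>l \<le> min k (n - k)\<close> enters: for such \<open>l\<close> the
  inclusion matrix between the \<open>l\<close>-subsets and the \<open>k\<close>-subsets of an \<open>n\<close>-set is injective over a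
  domain of characteristic zero (a theorem of Gottlieb and Kantor). The form used here,
  \<open>subset_sums_constant_imp_constant\<close>, says that constant sums come only from constant functions.
  It applies directly with polynomials as values, so coefficients of characteristic
  polynomials never have to be expressed by principal minors.
\<close>

section \<open>Functions on subsets of fixed size\<close>

text \<open>
  Any two sets of equal size are linked by exchanging one element of the current set outside
  \<open>\<gamma>\<close> for a missing element of \<open>\<gamma>\<close>; each exchange shrinks the difference to \<open>\<gamma>\<close> by one.
\<close>

lemma exchange_invariant_imp_constant:
  assumes "finite V"
    and exchange: "\<And>x y \<delta>. \<lbrakk>x \<in> V; y \<in> V; \<delta> \<subseteq> V; x \<notin> \<delta>; y \<notin> \<delta>; x \<noteq> y; Suc (card \<delta>) = l\<rbrakk>
                   \<Longrightarrow> f (insert x \<delta>) = f (insert y \<delta>)"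
    and "\<beta> \<subseteq> V" "card \<beta> = l" "\<gamma> \<subseteq> V" "card \<gamma> = l"
  shows "f \<beta> = f \<gamma>"
  using \<open>\<beta> \<subseteq> V\<close> \<open>card \<beta> = l\<close>
proof (induction "card (\<beta> - \<gamma>)" arbitrary: \<beta>)
  case 0
  have "finite \<beta>" "finite \<gamma>" using 0 assms finite_subset by blast+
  with 0 assms have "\<beta> \<subseteq> \<gamma>" by simp
  with \<open>finite \<gamma>\<close> 0 assms have "\<beta> = \<gamma>" by (simp add: card_subset_eq)
  then show ?case by simp
next
  case (Suc m)
  have fin: "finite \<beta>" "finite \<gamma>" using Suc assms finite_subset by blast+
  then have "card (\<gamma> - \<beta>) = Suc m"
    using Suc assms by (metis card_le_sym_Diff card_less_sym_Diff le_antisym order_refl)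
  then obtain x y where xy: "x \<in> \<beta>" "x \<notin> \<gamma>" "y \<in> \<gamma>" "y \<notin> \<beta>"
    using Suc.hyps(2) by (metis DiffE card.empty equals0I nat.distinct(1))
  let ?\<beta>' = "insert y (\<beta> - {x})"
  have cardb: "Suc (card (\<beta> - {x})) = l" using fin xy Suc.prems card_Suc_Diff1[of \<beta> x] by simp
  have "f \<beta> = f (insert x (\<beta> - {x}))" using xy by (simp add: insert_absorb)
  also have "\<dots> = f ?\<beta>'"
    using xy Suc.prems assms cardb by (intro exchange) auto
  also have "\<dots> = f \<gamma>"
  proof (rule Suc.hyps)
    have "?\<beta>' - \<gamma> = (\<beta> - \<gamma>) - {x}" using xy by auto
    then show "m = card (?\<beta>' - \<gamma>)" using Suc.hyps(2) xy fin by simp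
    show "?\<beta>' \<subseteq> V" using Suc.prems xy assms by auto
    show "card ?\<beta>' = l" using fin xy cardb by simp
  qed
  finally show ?case .
qed

lemma sum_card_Suc_subsets_insert:
  assumes "finite \<alpha>" "x \<notin> \<alpha>"
  shows "(\<Sum>\<beta> | \<beta> \<subseteq> insert x \<alpha> \<and> card \<beta> = Suc l. f \<beta>) =
         (\<Sum>\<beta> | \<beta> \<subseteq> \<alpha> \<and> card \<beta> = Suc l. f \<beta>) +
         (\<Sum>\<gamma> | \<gamma> \<subseteq> \<alpha> \<and> card \<gamma> = l. f (insert x \<gamma>) :: 'a :: comm_monoid_add)"
proof -
  let ?A = "{\<beta>. \<beta> \<subseteq> \<alpha> \<and> card \<beta> = Suc l}" and ?B = "{\<gamma>. \<gamma> \<subseteq> \<alpha> \<and> card \<gamma> = l}"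
  have split: "{\<beta>. \<beta> \<subseteq> insert x \<alpha> \<and> card \<beta> = Suc l} = ?A \<union> insert x ` ?B"
  proof (intro equalityI subsetI)
    fix \<beta> assume b: "\<beta> \<in> {\<beta>. \<beta> \<subseteq> insert x \<alpha> \<and> card \<beta> = Suc l}"
    then have fb: "finite \<beta>" using assms finite_subset by auto
    show "\<beta> \<in> ?A \<union> insert x ` ?B"
    proof (cases "x \<in> \<beta>")
      case True
      then have "\<beta> = insert x (\<beta> - {x})" "\<beta> - {x} \<in> ?B" using b fb by auto
      then show ?thesis by blast
    qed (use b in auto)
  next
    fix \<beta> assume "\<beta> \<in> ?A \<union> insert x ` ?B"
    then show "\<beta> \<in> {\<beta>. \<beta> \<subseteq> insert x \<alpha> \<and> card \<beta> = Suc l}"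
    proof
      assume "\<beta> \<in> insert x ` ?B"
      then obtain \<gamma> where g: "\<beta> = insert x \<gamma>" "\<gamma> \<subseteq> \<alpha>" "card \<gamma> = l" by auto
      then have "finite \<gamma>" "x \<notin> \<gamma>" using assms finite_subset by auto
      with g show ?thesis by auto
    qed auto
  qed
  have inj: "inj_on (insert x) ?B"
    using assms by (auto simp: inj_on_def)
  have fin: "finite ?A" "finite ?B" using assms by auto
  show ?thesis unfolding split
    by (subst sum.union_disjoint) (use assms fin inj in \<open>auto simp: sum.reindex\<close>)
qed

text \<open>
  Induction on \<open>l\<close>. For \<open>x \<noteq> y\<close>, the difference \<open>h \<gamma> = f (insert x \<gamma>) - f (insert y \<gamma>)\<close> is a
  function on the \<open>(l - 1)\<close>-subsets of \<open>V - {x, y}\<close>. Comparing the sums of \<open>f\<close> over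
  \<open>insert x \<alpha>\<close> and \<open>insert y \<alpha>\<close> for a \<open>(k - 1)\<close>-set \<open>\<alpha>\<close> shows that all sums of \<open>h\<close> vanish.
  Passing to \<open>V - {x, y}\<close> lowers the size of \<open>V\<close> by two and each of \<open>l\<close> and \<open>k\<close> by one,
  which preserves \<open>l + k \<le> card V\<close>. By induction \<open>h\<close> is constant, and its vanishing sums force that
  constant to be zero. So \<open>f\<close> is invariant under exchanging \<open>x\<close> for \<open>y\<close>.
\<close>

lemma subset_sums_constant_imp_constant:
  fixes f :: "'b set \<Rightarrow> 'a :: {idom, ring_char_0}"
  assumes "finite V" "l \<le> k" "l + k \<le> card V"
    and "\<And>\<alpha>. \<lbrakk>\<alpha> \<subseteq> V; card \<alpha> = k\<rbrakk> \<Longrightarrow> (\<Sum>\<beta> | \<beta> \<subseteq> \<alpha> \<and> card \<beta> = l. f \<beta>) = c"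
    and "\<beta> \<subseteq> V" "card \<beta> = l" "\<gamma> \<subseteq> V" "card \<gamma> = l"
  shows "f \<beta> = f \<gamma>"
  using assms
proof (induction l arbitrary: V k f c \<beta> \<gamma>)
  case 0
  then have "\<beta> = {}" "\<gamma> = {}" using finite_subset by fastforce+
  then show ?case by simp
next
  case (Suc l)
  then obtain k' where k: "k = Suc k'" by (cases k) auto
  note sums = Suc.prems(4)
  show ?case
  proof (rule exchange_invariant_imp_constant[OF \<open>finite V\<close> _ Suc.prems(5-8)])
    fix x y \<delta>
    assume xy: "x \<in> V" "y \<in> V" "x \<noteq> y" and \<delta>: "\<delta> \<subseteq> V" "x \<notin> \<delta>" "y \<notin> \<delta>" "Suc (card \<delta>) = Suc l"
    define W where "W = V - {x, y}"
    have finW: "finite W" and cardW: "card V = Suc (Suc (card W))"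
      using xy \<open>finite V\<close> card_Suc_Diff1[of V x] card_Suc_Diff1[of "V - {x}" y]
      unfolding W_def by (simp_all add: Diff_insert2[of V x "{y}"])
    define h where "h = (\<lambda>\<gamma>. f (insert x \<gamma>) - f (insert y \<gamma>))"
    have h_sums: "(\<Sum>\<gamma> | \<gamma> \<subseteq> \<alpha> \<and> card \<gamma> = l. h \<gamma>) = 0" if "\<alpha> \<subseteq> W" "card \<alpha> = k'" for \<alpha>
    proof -
      have "finite \<alpha>" "x \<notin> \<alpha>" "y \<notin> \<alpha>" using that finW finite_subset unfolding W_def by auto
      moreover have "insert x \<alpha> \<subseteq> V" "insert y \<alpha> \<subseteq> V" using that xy unfolding W_def by auto
      ultimately have
        "(\<Sum>\<beta> | \<beta> \<subseteq> \<alpha> \<and> card \<beta> = Suc l. f \<beta>) + (\<Sum>\<gamma> | \<gamma> \<subseteq> \<alpha> \<and> card \<gamma> = l. f (insert x \<gamma>)) = c"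
        "(\<Sum>\<beta> | \<beta> \<subseteq> \<alpha> \<and> card \<beta> = Suc l. f \<beta>) + (\<Sum>\<gamma> | \<gamma> \<subseteq> \<alpha> \<and> card \<gamma> = l. f (insert y \<gamma>)) = c"
        using sums[of "insert x \<alpha>"] sums[of "insert y \<alpha>"] that k
        by (simp_all add: sum_card_Suc_subsets_insert)
      note insert_sums = this
      from add_left_imp_eq[OF trans[OF insert_sums(1) insert_sums(2)[symmetric]]]
      show ?thesis unfolding h_def sum_subtractf by simp
    qed
    have \<delta>W: "\<delta> \<subseteq> W" "card \<delta> = l" using \<delta> unfolding W_def by auto
    have h_const: "h \<gamma> = h \<delta>" if "\<gamma> \<subseteq> W" "card \<gamma> = l" for \<gamma>
      using Suc.prems k cardW that \<delta>W
      by (intro Suc.IH[where V = W and k = k' and c = 0] finW h_sums) auto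
    \<comment> \<open>On any one \<open>\<alpha>\<close>, the constant occurs \<open>k' choose l\<close> times in a sum that vanishes. This count is
        nonzero since \<open>l \<le> k'\<close>.\<close>
    have "k' \<le> card W" using Suc.prems k cardW by simp
    then obtain \<alpha> where \<alpha>: "\<alpha> \<subseteq> W" "card \<alpha> = k'" by (metis obtain_subset_with_card_n)
    have fin\<alpha>: "finite \<alpha>" using \<alpha> finW finite_subset by blast
    have "0 = (\<Sum>\<gamma> | \<gamma> \<subseteq> \<alpha> \<and> card \<gamma> = l. h \<gamma>)" using h_sums[OF \<alpha>] by simp
    also have "\<dots> = (\<Sum>\<gamma> | \<gamma> \<subseteq> \<alpha> \<and> card \<gamma> = l. h \<delta>)"
      using \<alpha> by (intro sum.cong h_const) auto
    also have "\<dots> = of_nat (k' choose l) * h \<delta>"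
      using fin\<alpha> \<alpha> by (simp add: n_subsets)
    finally have "h \<delta> = 0" using Suc.prems k by (simp add: binomial_eq_0_iff)
    then show "f (insert x \<delta>) = f (insert y \<delta>)" unfolding h_def by simp
  qed
qed

section \<open>Derivatives of characteristic polynomials of principal submatrices\<close>

text \<open>
  Deleting the \<open>i\<close>-th smallest element moves all later elements down by one position. This is the
  index shift that \<^const>\<open>mat_delete\<close> performs on rows and columns.
\<close>

lemma pick_remove:
  assumes "i < card S" "Suc j < card S"
  shows "pick (S - {pick S i}) j = pick S (if j < i then j else Suc j)"
proof -
  let ?m = "if j < i then j else Suc j"
  let ?y = "pick S ?m"
  have fin: "finite S" using assms card.infinite by fastforce
  have m: "?m < card S" "?m \<noteq> i" using assms by auto
  have yS: "?y \<in> S" "pick S i \<in> S" using pick_in_set_le[OF m(1)] pick_in_set_le[OF assms(1)] by blast+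
  have lt: "pick S i < ?y \<longleftrightarrow> i < ?m" and ne: "?y \<noteq> pick S i"
    using m assms pick_mono_le[of ?m S i] pick_mono_le[of i S ?m] by (metis nat_neq_iff less_asym)+
  \<comment> \<open>An element of a set is picked at the position that counts the smaller elements.\<close>
  have "card {a \<in> S - {pick S i}. a < ?y} = card ({a \<in> S. a < ?y} - {pick S i})"
    by (rule arg_cong[where f = card]) auto
  also have "\<dots> = (if pick S i < ?y then ?m - 1 else ?m)"
    using fin yS card_pick_le[OF m(1)] by (simp add: card_Diff_singleton_if)
  also have "\<dots> = j" unfolding lt by auto
  finally have "card {a \<in> S - {pick S i}. a < ?y} = j" .
  moreover have "?y \<in> S - {pick S i}" using yS ne by auto
  ultimately show ?thesis using pick_card_in_set by metis
qed

lemma principal_submatrix_index: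
  assumes "\<alpha> \<subseteq> {..<n}" "A \<in> carrier_mat n n" "i < card \<alpha>" "j < card \<alpha>"
  shows "principal_submatrix A \<alpha> $$ (i, j) = A $$ (pick \<alpha> i, pick \<alpha> j)"
proof -
  have "{i. i < n \<and> i \<in> \<alpha>} = \<alpha>" using assms(1) by auto
  then show ?thesis using assms by (simp add: principal_submatrix_def submatrix_index)
qed

lemma principal_submatrix_carrier:
  assumes "\<alpha> \<subseteq> {..<n}" "A \<in> carrier_mat n n"
  shows "principal_submatrix A \<alpha> \<in> carrier_mat (card \<alpha>) (card \<alpha>)"
proof -
  have "{i. i < n \<and> i \<in> \<alpha>} = \<alpha>" using assms(1) by auto
  then show ?thesis using assms by (auto simp: principal_submatrix_def dim_submatrix)
qed

lemma mat_delete_principal_submatrix: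
  assumes "\<alpha> \<subseteq> {..<n}" "A \<in> carrier_mat n n" "i < card \<alpha>"
  shows "mat_delete (principal_submatrix A \<alpha>) i i = principal_submatrix A (\<alpha> - {pick \<alpha> i})"
    (is "?L = ?R")
proof -
  let ?\<alpha>' = "\<alpha> - {pick \<alpha> i}"
  have sub: "?\<alpha>' \<subseteq> {..<n}" using assms by auto
  have card: "card ?\<alpha>' = card \<alpha> - 1"
    using assms pick_in_set_le by (simp add: card_Diff_singleton)
  note carr = principal_submatrix_carrier[OF assms(1,2)] principal_submatrix_carrier[OF sub assms(2)]
  show ?thesis
  proof (rule eq_matI)
    fix r s assume "r < dim_row ?R" "s < dim_col ?R"
    then have rs: "r < card \<alpha> - 1" "s < card \<alpha> - 1" using carr card by auto
    then have "?L $$ (r, s) = principal_submatrix A \<alpha> $$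
        (if r < i then r else Suc r, if s < i then s else Suc s)"
      using carr by (simp add: mat_delete_def)
    also have "\<dots> = A $$ (pick ?\<alpha>' r, pick ?\<alpha>' s)"
      using rs assms by (simp add: principal_submatrix_index pick_remove)
    also have "\<dots> = ?R $$ (r, s)"
      using rs card by (simp add: principal_submatrix_index[OF sub assms(2)])
    finally show "?L $$ (r, s) = ?R $$ (r, s)" .
  qed (use carr card in auto)
qed

lemma bij_betw_pick:
  assumes "finite S"
  shows "bij_betw (pick S) {..<card S} S"
proof -
  have "inj_on (pick S) {..<card S}"
    by (intro inj_onI) (metis lessThan_iff nat_neq_iff pick_mono_le less_irrefl)
  moreover have "pick S ` {..<card S} \<subseteq> S" by (auto intro: pick_in_set_le)
  ultimately show ?thesis
    using assms by (simp add: bij_betw_def card_image card_subset_eq)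
qed

lemma pderiv_char_poly_principal_submatrix:
  fixes A :: "'a :: idom mat"
  assumes "\<alpha> \<subseteq> {..<n}" "A \<in> carrier_mat n n"
  shows "pderiv (char_poly (principal_submatrix A \<alpha>)) =
         (\<Sum>i\<in>\<alpha>. char_poly (principal_submatrix A (\<alpha> - {i})))"
proof -
  have "finite \<alpha>" using assms finite_subset by blast
  have "pderiv (char_poly (principal_submatrix A \<alpha>)) =
        (\<Sum>i<card \<alpha>. char_poly (principal_submatrix A (\<alpha> - {pick \<alpha> i})))"
    using assms
    by (simp add: pderiv_char_poly[OF principal_submatrix_carrier] mat_delete_principal_submatrix)
  also have "\<dots> = (\<Sum>i\<in>\<alpha>. char_poly (principal_submatrix A (\<alpha> - {i})))"
    by (rule sum.reindex_bij_betw[OF bij_betw_pick[OF \<open>finite \<alpha>\<close>]])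
  finally show ?thesis .
qed

text \<open>
  Double counting: a \<open>j\<close>-subset \<open>\<gamma>\<close> of \<open>\<alpha>\<close> arises as \<open>\<beta> - {i}\<close> exactly once for each
  \<open>i \<in> \<alpha> - \<gamma>\<close>, namely from \<open>\<beta> = insert i \<gamma>\<close>.
\<close>

lemma sum_subsets_remove_one:
  fixes p :: "'b set \<Rightarrow> 'a :: semiring_1"
  assumes "finite \<alpha>"
  shows "(\<Sum>\<beta> | \<beta> \<subseteq> \<alpha> \<and> card \<beta> = Suc j. \<Sum>i\<in>\<beta>. p (\<beta> - {i})) =
         of_nat (card \<alpha> - j) * (\<Sum>\<gamma> | \<gamma> \<subseteq> \<alpha> \<and> card \<gamma> = j. p \<gamma>)"
proof -
  let ?B = "\<lambda>m. {\<beta>. \<beta> \<subseteq> \<alpha> \<and> card \<beta> = m}"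
  have fin: "finite (?B m)" and fin_subset: "\<beta> \<subseteq> \<alpha> \<Longrightarrow> finite \<beta>" for m \<beta>
    using assms finite_subset by auto
  have "(\<Sum>\<beta>\<in>?B (Suc j). \<Sum>i\<in>\<beta>. p (\<beta> - {i})) = (\<Sum>(\<beta>, i)\<in>Sigma (?B (Suc j)) (\<lambda>\<beta>. \<beta>). p (\<beta> - {i}))"
    by (rule sum.Sigma) (auto simp: fin fin_subset)
  also have "\<dots> = (\<Sum>(\<gamma>, i)\<in>Sigma (?B j) (\<lambda>\<gamma>. \<alpha> - \<gamma>). p \<gamma>)"
    by (rule sum.reindex_bij_witness[where i = "\<lambda>(\<gamma>, i). (insert i \<gamma>, i)"
          and j = "\<lambda>(\<beta>, i). (\<beta> - {i}, i)"])
       (auto simp: insert_absorb fin_subset)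
  also have "\<dots> = (\<Sum>\<gamma>\<in>?B j. \<Sum>i\<in>\<alpha> - \<gamma>. p \<gamma>)"
    by (rule sum.Sigma[symmetric]) (auto simp: fin assms)
  also have "\<dots> = (\<Sum>\<gamma>\<in>?B j. of_nat (card \<alpha> - j) * p \<gamma>)"
    by (rule sum.cong) (auto simp: fin_subset card_Diff_subset)
  finally show ?thesis by (simp add: sum_distrib_left)
qed

text \<open>
  Let \<open>S j \<delta>\<close> be the sum of the characteristic polynomials over the \<open>j\<close>-subsets of \<open>\<delta>\<close>. The
  derivative formula and double counting give \<open>(S (j + 1) \<delta>)' = (card \<delta> - j) S j \<delta>\<close>, so an
  equality of the sums descends from size \<open>j + 1\<close> to size \<open>j\<close> as long as \<open>j < k\<close>: the factor
  \<open>k - j\<close> can then be cancelled. The descent starts at \<open>S k \<alpha>\<close>, whose only summand belongs to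
  \<open>\<alpha>\<close> itself.
\<close>

lemma char_poly_subset_sums_eq:
  fixes A :: "'a :: {idom, ring_char_0} mat"
  assumes A: "A \<in> carrier_mat n n" and "l \<le> k"
    and \<alpha>: "\<alpha> \<subseteq> {..<n}" "card \<alpha> = k" and \<beta>: "\<beta> \<subseteq> {..<n}" "card \<beta> = k"
    and eq: "char_poly (principal_submatrix A \<alpha>) = char_poly (principal_submatrix A \<beta>)"
  shows "(\<Sum>\<gamma> | \<gamma> \<subseteq> \<alpha> \<and> card \<gamma> = l. char_poly (principal_submatrix A \<gamma>)) =
         (\<Sum>\<gamma> | \<gamma> \<subseteq> \<beta> \<and> card \<gamma> = l. char_poly (principal_submatrix A \<gamma>))"
proof -
  let ?p = "\<lambda>\<gamma>. char_poly (principal_submatrix A \<gamma>)"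
  define S where "S = (\<lambda>l \<alpha>. \<Sum>\<gamma> | \<gamma> \<subseteq> \<alpha> \<and> card \<gamma> = l. ?p \<gamma>)"
  have fin: "finite \<alpha>" "finite \<beta>" using \<alpha> \<beta> finite_subset by blast+
  have deriv: "pderiv (S (Suc j) \<delta>) = of_nat (card \<delta> - j) * S j \<delta>" if "\<delta> \<subseteq> {..<n}" for j \<delta>
  proof -
    have "pderiv (S (Suc j) \<delta>) = (\<Sum>\<gamma> | \<gamma> \<subseteq> \<delta> \<and> card \<gamma> = Suc j. pderiv (?p \<gamma>))"
      unfolding S_def by (simp add: pderiv_sum)
    also have "\<dots> = (\<Sum>\<gamma> | \<gamma> \<subseteq> \<delta> \<and> card \<gamma> = Suc j. \<Sum>i\<in>\<gamma>. ?p (\<gamma> - {i}))"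
      using that by (intro sum.cong refl pderiv_char_poly_principal_submatrix[OF _ A]) auto
    also have "\<dots> = of_nat (card \<delta> - j) * S j \<delta>"
      unfolding S_def by (rule sum_subsets_remove_one) (use that finite_subset in blast)
    finally show ?thesis .
  qed
  have top: "S k \<delta> = ?p \<delta>" if "finite \<delta>" "card \<delta> = k" for \<delta>
  proof -
    have "\<gamma> \<subseteq> \<delta> \<and> card \<gamma> = k \<longleftrightarrow> \<gamma> = \<delta>" for \<gamma>
      using that by (metis card_subset_eq order_refl)
    then show ?thesis unfolding S_def by simp
  qed
  have "S l \<alpha> = S l \<beta>"
    using \<open>l \<le> k\<close>
  proof (induction rule: inc_induct)
    case base
    then show ?case using fin \<alpha> \<beta> eq top by simp
  next
    case (step j)
    then have "of_nat (k - j) * S j \<alpha> = of_nat (k - j) * S j \<beta>"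
      using deriv[OF \<alpha>(1), of j] deriv[OF \<beta>(1), of j] \<alpha> \<beta> by simp
    then show ?case using step by (simp del: of_nat_diff)
  qed
  then show ?thesis unfolding S_def .
qed

section \<open>Spectral monomorphy passes to smaller sizes\<close>

theorem proposition2p2:
  fixes n k :: nat and A :: "complex mat"
  assumes "n \<ge> 1"
    and "k \<in> {1..n}"
    and "A \<in> carrier_mat n n"
    and "spectrally_monomorphic k A"
  shows "\<forall>l \<in> {1..min k (n - k)}. spectrally_monomorphic l A"
proof
  fix l assume "l \<in> {1..min k (n - k)}"
  then have l: "l \<le> k" "l + k \<le> card {..<n}" by auto
  let ?p = "\<lambda>\<gamma>. char_poly (principal_submatrix A \<gamma>)"
  let ?S = "\<lambda>\<alpha>. \<Sum>\<gamma> | \<gamma> \<subseteq> \<alpha> \<and> card \<gamma> = l. ?p \<gamma>"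
  have dim: "dim_row A = n" using assms by simp
  have sums: "?S \<alpha> = ?S {..<k}" if "\<alpha> \<subseteq> {..<n}" "card \<alpha> = k" for \<alpha>
  proof (rule char_poly_subset_sums_eq[OF assms(3) l(1) that])
    show "{..<k} \<subseteq> {..<n}" "card {..<k} = k" using assms(2) by auto
    then show "?p \<alpha> = ?p {..<k}"
      using assms(4) that unfolding spectrally_monomorphic_def dim by blast
  qed
  have "?p \<beta> = ?p \<gamma>"
    if "\<beta> \<subseteq> {..<n}" "card \<beta> = l" "\<gamma> \<subseteq> {..<n}" "card \<gamma> = l" for \<beta> \<gamma>
    by (rule subset_sums_constant_imp_constant[OF _ l sums that]) auto
  then show "spectrally_monomorphic l A"
    unfolding spectrally_monomorphic_def dim by blast
qed

end
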